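(* Let $A\in\mathbb{R}^{n\times n}$ be symmetric positive definite, $\bm b\in\mathbb{R}^n$, and $f(\bm x)=\frac12\bm x^TA\bm x-\bm b^T\bm x$. Let $L,\ell$ be real numbers with $L>0$, $\ell\ge 0$ such that $f$ is $L$-smooth and $\ell$-strongly convex. Let $\bm x_0\in\mathbb{R}^n$, let $\bm x_0,\bm x_1,\bm x_2,\ldots$ be the conjugate gradient iterates for $f$ started at $\bm x_0$, and let $\gamma_k,\theta_k,\bm v_k,\phi_k^*$ be the estimate-sequence quantities defined in the context, with initial vector $\bm v_0=\bm x_0$ and with gradient sequence $\bar{\bm x}_k:=\bm x_k$ for every $k$. Then $f(\bm x_k)\le\phi_k^*$ for every iteration $k$.
   Context: All norms are Euclidean. A differentiable $f:\mathbb{R}^n\to\mathbb{R}$ is $L$-smooth (and convex) if $0\le f(\bm y)-f(\bm x)-\nabla f(\bm x)^T(\bm y-\bm x)\le \frac L2\|\bm x-\bm y\|^2$ for all $\bm x,\bm y$, and $\ell$-strongly convex ($\ell\ge0$) if $f(\bm y)-f(\bm x)-\nabla f(\bm x)^T(\bm y-\bm x)\ge\frac{\ell}{2}\|\bm x-\bm y\|^2$ for all $\bm x,\bm y$. Conjugate gradient iterates for the quadratic $f$: $\bm p_0=-\nabla f(\bm x_0)$; for $k\ge0$, as long as $\nabla f(\bm x_k)\ne\bm 0$, $\alpha_k=-\nabla f(\bm x_k)^T\bm p_k/(\bm p_k^TA\bm p_k)$, $\bm x_{k+1}=\bm x_k+\alpha_k\bm p_k$, $\bm p_{k+1}=-\nabla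 f(\bm x_{k+1})+\beta_{k+1}\bm p_k$ with $\beta_{k+1}=\|\nabla f(\bm x_{k+1})\|^2/\|\nabla f(\bm x_k)\|^2$. The iteration stops once $\nabla f(\bm x_k)=\bm 0$; "every iteration $k$" means every $k$ for which $\bm x_k$ is defined. Estimate sequence: given a gradient sequence $\bar{\bm x}_0,\bar{\bm x}_1,\ldots$ and a vector $\bm v_0$, set $\gamma_0=L$, $\phi_0^*=f(\bm x_0)$ (so $\phi_0(\bm x)=f(\bm x_0)+\frac L2\|\bm x-\bm v_0\|^2$). For $k\ge0$, let $\theta_k$ be the positive root of $L\theta^2+(\gamma_k-\ell)\theta-\gamma_k=0$ and define $$\gamma_{k+1}=(1-\theta_k)\gamma_k+\theta_k\ell,$$ $$\bm v_{k+1}=\tfrac1{\gamma_{k+1}}\left[(1-\theta_k)\gamma_k\bm v_k+\theta_k\ell\bar{\bm x}_k-\theta_k\nabla f(\bar{\bm x}_k)\right],$$ $$\phi_{k+1}^*=(1-\theta_k)\phi_k^*+\theta_kf(\bar{\bm x}_k)-\tfrac{\theta_k^2}{2\gamma_{k+1}}\|\nabla f(\bar{\bm x}_k)\|^2+\tfrac{\theta_k(1-\theta_k)\gamma_k}{\gamma_{k+1}}\left(\tfrac{\ell}{2}\|\bar{\bm x}_k-\bm v_k\|^2+\nabla f(\bar{\bm x}_k)^T(\bm v_k-\bar{\bm x}_k)\right).$$ Equivalently, $\phi_k(\bm x)=\phi_k^*+\frac{\gamma_k}{2}\|\bm x-\bm v_k\|^2$ satisfies $\phi_{k+1}(\bm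 x)=(1-\theta_k)\phi_k(\bm x)+\theta_k[f(\bar{\bm x}_k)+\nabla f(\bar{\bm x}_k)^T(\bm x-\bar{\bm x}_k)+\frac{\ell}{2}\|\bm x-\bar{\bm x}_k\|^2]$. *)

theory Defs
  imports "HOL-Analysis.Analysis"
begin

definition grad :: "('a::euclidean_space \<Rightarrow> real) \<Rightarrow> 'a \<Rightarrow> 'a" where
  "grad f x = (THE D. GDERIV f x :> D)"

definition L_smooth :: "real \<Rightarrow> ('a::euclidean_space \<Rightarrow> real) \<Rightarrow> bool" where
  "L_smooth L f \<longleftrightarrow>
     (\<forall>x. f differentiable (at x)) \<and>
     (\<forall>x y. 0 \<le> f y - f x - grad f x \<bullet> (y - x) \<and>
            f y - f x - grad f x \<bullet> (y - x) \<le> L / 2 * (norm (x - y))\<^sup>2)"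

definition strongly_convex :: "real \<Rightarrow> ('a::euclidean_space \<Rightarrow> real) \<Rightarrow> bool" where
  "strongly_convex l f \<longleftrightarrow>
     (\<forall>x. f differentiable (at x)) \<and>
     (\<forall>x y. f y - f x - grad f x \<bullet> (y - x) \<ge> l / 2 * (norm (x - y))\<^sup>2)"

definition sym_pos_def :: "real^'n^'n \<Rightarrow> bool" where
  "sym_pos_def A \<longleftrightarrow> transpose A = A \<and> (\<forall>x. x \<noteq> 0 \<longrightarrow> x \<bullet> (A *v x) > 0)"

definition quadratic :: "real^'n^'n \<Rightarrow> real^'n \<Rightarrow> real^'n \<Rightarrow> real" where
  "quadratic A b x = 1 / 2 * (x \<bullet> (A *v x)) - b \<bullet> x"


text \<open>The pair (iterate, search direction) of the conjugate gradient method. The recursion is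
  total; its values are meaningful only for those indices that satisfy \<open>cg_defined\<close> below,
  i.e. as long as the method has not stopped at an earlier iterate.\<close>

primrec cg_state ::
  "(real^'n \<Rightarrow> real) \<Rightarrow> real^'n^'n \<Rightarrow> real^'n \<Rightarrow> nat \<Rightarrow> (real^'n) \<times> (real^'n)" where
  "cg_state f A x0 0 = (x0, - grad f x0)"
| "cg_state f A x0 (Suc k) =
     (let x = fst (cg_state f A x0 k);
          p = snd (cg_state f A x0 k);
          \<alpha> = - (grad f x \<bullet> p) / (p \<bullet> (A *v p));
          x' = x + \<alpha> *\<^sub>R p;
          \<beta> = (norm (grad f x'))\<^sup>2 / (norm (grad f x))\<^sup>2
      in (x', - grad f x' + \<beta> *\<^sub>R p))"

definition cg_x :: "(real^'n \<Rightarrow> real) \<Rightarrow> real^'n^'n \<Rightarrow> real^'n \<Rightarrow> nat \<Rightarrow> real^'n" where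
  "cg_x f A x0 k = fst (cg_state f A x0 k)"

definition cg_defined :: "(real^'n \<Rightarrow> real) \<Rightarrow> real^'n^'n \<Rightarrow> real^'n \<Rightarrow> nat \<Rightarrow> bool" where
  "cg_defined f A x0 k \<longleftrightarrow> (\<forall>j<k. grad f (cg_x f A x0 j) \<noteq> 0)"


text \<open>The positive root is unique whenever \<open>L > 0\<close> and \<open>\<gamma> > 0\<close>.\<close>

definition theta_root :: "real \<Rightarrow> real \<Rightarrow> real \<Rightarrow> real" where
  "theta_root L l \<gamma> = (THE \<theta>. \<theta> > 0 \<and> L * \<theta>\<^sup>2 + (\<gamma> - l) * \<theta> - \<gamma> = 0)"

primrec est_gamma :: "real \<Rightarrow> real \<Rightarrow> nat \<Rightarrow> real" where
  "est_gamma L l 0 = L"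
| "est_gamma L l (Suc k) =
     (1 - theta_root L l (est_gamma L l k)) * est_gamma L l k
       + theta_root L l (est_gamma L l k) * l"

definition est_theta :: "real \<Rightarrow> real \<Rightarrow> nat \<Rightarrow> real" where
  "est_theta L l k = theta_root L l (est_gamma L l k)"

text \<open>In the following, \<open>xb\<close> is the gradient sequence, \<open>v0\<close> the initial vector, and
  \<open>x0\<close> the point that fixes the initial value \<open>f x0\<close>.\<close>

primrec est_v ::
  "('a::euclidean_space \<Rightarrow> real) \<Rightarrow> real \<Rightarrow> real \<Rightarrow> (nat \<Rightarrow> 'a) \<Rightarrow> 'a \<Rightarrow> nat \<Rightarrow> 'a" where
  "est_v f L l xb v0 0 = v0"
| "est_v f L l xb v0 (Suc k) =
     (let \<theta> = est_theta L l k; \<gamma> = est_gamma L l k; \<gamma>' = est_gamma L l (Suc k) in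
      (1 / \<gamma>') *\<^sub>R
        (((1 - \<theta>) * \<gamma>) *\<^sub>R est_v f L l xb v0 k + (\<theta> * l) *\<^sub>R xb k - \<theta> *\<^sub>R grad f (xb k)))"

primrec est_phi ::
  "('a::euclidean_space \<Rightarrow> real) \<Rightarrow> real \<Rightarrow> real \<Rightarrow> (nat \<Rightarrow> 'a) \<Rightarrow> 'a \<Rightarrow> 'a \<Rightarrow> nat \<Rightarrow> real" where
  "est_phi f L l xb v0 x0 0 = f x0"
| "est_phi f L l xb v0 x0 (Suc k) =
     (let \<theta> = est_theta L l k; \<gamma> = est_gamma L l k; \<gamma>' = est_gamma L l (Suc k);
          v = est_v f L l xb v0 k in
      (1 - \<theta>) * est_phi f L l xb v0 x0 k + \<theta> * f (xb k)
        - \<theta>\<^sup>2 / (2 * \<gamma>') * (norm (grad f (xb k)))\<^sup>2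
        + \<theta> * (1 - \<theta>) * \<gamma> / \<gamma>' *
            (l / 2 * (norm (xb k - v))\<^sup>2 + grad f (xb k) \<bullet> (v - xb k)))"

end

theory Submission
  imports Defs
begin

text \<open>The choice of \<open>\<theta>\<^sub>k\<close> means \<open>\<gamma>\<^sub>k\<^sub>+\<^sub>1 = L \<theta>\<^sub>k\<^sup>2\<close>, so that \<open>\<phi>\<^sub>k\<^sub>+\<^sub>1\<^sup>*\<close> contains the term
  \<open>- \<parallel>\<nabla>f(x\<^sub>k)\<parallel>\<^sup>2 / (2L)\<close>. Both \<open>x\<^sub>k\<close> and \<open>v\<^sub>k\<close> lie in \<open>x\<^sub>0\<close> plus the span of the earlier gradients,
  to which \<open>\<nabla>f(x\<^sub>k)\<close> is orthogonal; hence the inner product in \<open>\<phi>\<^sub>k\<^sub>+\<^sub>1\<^sup>*\<close> vanishes, and by induction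
  \<open>\<phi>\<^sub>k\<^sub>+\<^sub>1\<^sup>* \<ge> f(x\<^sub>k) - \<parallel>\<nabla>f(x\<^sub>k)\<parallel>\<^sup>2 / (2L) \<ge> f(x\<^sub>k - \<nabla>f(x\<^sub>k) / L)\<close>. The last value is at least \<open>f(x\<^sub>k\<^sub>+\<^sub>1)\<close>,
  because \<open>\<nabla>f(x\<^sub>k\<^sub>+\<^sub>1)\<close> is orthogonal to both the gradient and the search direction at \<open>x\<^sub>k\<close>.\<close>

lemma grad_eqI: "GDERIV f x :> D \<Longrightarrow> grad f x = D"
  unfolding grad_def
proof (rule the_equality)
  fix D' assume "GDERIV f x :> D" "GDERIV f x :> D'"
  then have "(\<lambda>h. h \<bullet> D') = (\<lambda>h. h \<bullet> D)"
    unfolding gderiv_def by (rule has_derivative_unique[rotated])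
  then show "D' = D"
    by (metis inner_commute vector_eq_ldot)
qed

lemma grad_quadratic:
  assumes "transpose A = A"
  shows "grad (quadratic A b) x = A *v x - b"
proof (rule grad_eqI)
  \<comment> \<open>Symmetry merges the two cross terms in the derivative of the quadratic
    form.\<close>
  have sym: "x \<bullet> (A *v h) = h \<bullet> (A *v x)" for h
    by (metis assms dot_lmul_matrix inner_commute transpose_matrix_vector)
  have "((\<lambda>x. 1 / 2 * (x \<bullet> (A *v x)) - b \<bullet> x) has_derivative
      (\<lambda>h. 1 / 2 * (x \<bullet> (A *v h) + h \<bullet> (A *v x)) - b \<bullet> h)) (at x)"
    by (auto intro!: derivative_eq_intros
        bounded_linear.has_derivative[OF matrix_vector_mul_bounded_linear])
  then show "GDERIV (quadratic A b) x :> A *v x - b"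
    unfolding gderiv_def quadratic_def[abs_def]
    by (simp add: sym inner_diff_right inner_commute)
qed

text \<open>The relations support each other in one induction. The old ones and the choice of
  \<open>a k\<close> make the new gradient orthogonal to all earlier directions, hence to all
  earlier gradients, which are combinations of directions. Conjugacy of the new direction follows
  because \<open>T (p j)\<close> is a multiple of \<open>g (Suc j) - g j\<close>;
  \<open>a j \<noteq> 0\<close> is carried along to allow this division.\<close>

lemma conjugate_gradient_orthogonality:
  fixes g p :: "nat \<Rightarrow> 'a::real_inner" and T :: "'a \<Rightarrow> 'a"
  assumes sym: "\<And>u v. u \<bullet> T v = v \<bullet> T u"
    and pos: "\<And>u. u \<noteq> 0 \<Longrightarrow> u \<bullet> T u > 0"
    and a: "\<And>k. a k = - (g k \<bullet> p k) / (p k \<bullet> T (p k))"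
    and p0: "p 0 = - g 0"
    and g_Suc: "\<And>k. g (Suc k) = g k + a k *\<^sub>R T (p k)"
    and p_Suc: "\<And>k. p (Suc k) = - g (Suc k) + ((norm (g (Suc k)))\<^sup>2 / (norm (g k))\<^sup>2) *\<^sub>R p k"
    and nz: "\<And>j. j < k \<Longrightarrow> g j \<noteq> 0"
  shows "g k \<bullet> p k = - (norm (g k))\<^sup>2 \<and>
    (\<forall>j<k. a j \<noteq> 0 \<and> g k \<bullet> g j = 0 \<and> g k \<bullet> p j = 0 \<and> p k \<bullet> T (p j) = 0)"
  using nz
proof (induction k)
  case 0
  then show ?case by (simp add: p0 power2_norm_eq_inner)
next
  case (Suc k)
  then have IH: "g k \<bullet> p k = - (norm (g k))\<^sup>2" "\<And>j. j < k \<Longrightarrow> a j \<noteq> 0"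
      "\<And>j. j < k \<Longrightarrow> g k \<bullet> p j = 0" "\<And>j. j < k \<Longrightarrow> p k \<bullet> T (p j) = 0"
    by auto
  have gk: "g k \<noteq> 0" using Suc.prems by simp
  then have "p k \<noteq> 0" using IH(1) by auto
  then have pTp: "p k \<bullet> T (p k) > 0" by (rule pos)
  have ak: "a k = (norm (g k))\<^sup>2 / (p k \<bullet> T (p k))" by (simp add: a IH(1))
  have a_nz: "a j \<noteq> 0" if "j < Suc k" for j
    using that IH(2) gk pTp by (cases "j = k") (auto simp: ak)
  have gp: "g (Suc k) \<bullet> p j = 0" if "j < Suc k" for j
  proof (cases "j = k")
    case True
    then show ?thesis using pTp
      by (simp add: g_Suc inner_add_left inner_diff_left a inner_commute[of "T (p k)"])
  next
    case False
    then have "j < k" using that by simp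
    then show ?thesis
      using IH(3,4)[of j] sym[of "p j" "p k"]
      by (simp add: g_Suc inner_add_left inner_commute[of "T (p k)"])
  qed
  have gg: "g (Suc k) \<bullet> g j = 0" if "j < Suc k" for j
  proof (cases j)
    case 0
    then show ?thesis using gp[of 0] by (simp add: p0)
  next
    case (Suc i)
    have "g j = ((norm (g j))\<^sup>2 / (norm (g i))\<^sup>2) *\<^sub>R p i - p j"
      unfolding Suc p_Suc by simp
    then show ?thesis
      using gp[of j] gp[of i] that Suc by (metis Suc_lessD diff_zero inner_diff_right
          inner_scaleR_right mult_zero_right)
  qed
  have Tp: "T (p j) = (1 / a j) *\<^sub>R (g (Suc j) - g j)" if "j < Suc k" for j
    using a_nz[OF that] by (simp add: g_Suc)
  have pT: "p (Suc k) \<bullet> T (p j) = 0" if "j < Suc k" for j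
  proof (cases "j = k")
    case True
    \<comment> \<open>Since \<open>a k * (p k \<bullet> T (p k))\<close> is the squared norm of
      \<open>g k\<close>, the coefficient of \<open>p k\<close> in \<open>p_Suc\<close> cancels
      exactly this term.\<close>
    have "g (Suc k) \<bullet> T (p k) = (norm (g (Suc k)))\<^sup>2 / a k"
      using gg[of k] by (simp add: Tp inner_diff_right power2_norm_eq_inner)
    then show ?thesis
      using True pTp gk by (simp add: p_Suc inner_diff_left ak)
  next
    case False
    then have "j < k" using that by simp
    then have "g (Suc k) \<bullet> T (p j) = 0"
      using gg[of "Suc j"] gg[of j] by (simp add: Tp inner_diff_right)
    then show ?thesis
      using IH(4)[OF \<open>j < k\<close>] by (simp add: p_Suc inner_diff_left)
  qed
  have "g (Suc k) \<bullet> p (Suc k) = - (norm (g (Suc k)))\<^sup>2"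
    using gp[of k] by (simp add: p_Suc inner_diff_right power2_norm_eq_inner)
  then show ?case using a_nz gg gp pT by blast
qed

lemma theta_root_properties:
  assumes L: "L > 0" and "\<gamma> > 0" and "l \<le> L"
  defines "\<theta> \<equiv> theta_root L l \<gamma>"
  shows "0 < \<theta>" and "\<theta> \<le> 1" and "(1 - \<theta>) * \<gamma> + \<theta> * l = L * \<theta>\<^sup>2"
proof -
  let ?q = "\<lambda>t. L * t\<^sup>2 + (\<gamma> - l) * t - \<gamma>"
  \<comment> \<open>The polynomial is \<open>-\<gamma>\<close> at 0 and \<open>L - l\<close> at
    1.\<close>
  have "\<exists>t. 0 \<le> t \<and> t \<le> 1 \<and> ?q t = 0"
    by (rule IVT') (use assms in \<open>auto intro!: continuous_intros\<close>)
  then obtain t where t: "0 \<le> t" "t \<le> 1" "?q t = 0" by blast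
  have "t \<noteq> 0" using t(3) \<open>\<gamma> > 0\<close> by auto
  then have tpos: "t > 0" using t(1) by simp
  have "\<theta> = t"
    unfolding \<theta>_def theta_root_def
  proof (rule the_equality)
    fix s assume s: "s > 0 \<and> ?q s = 0"
    \<comment> \<open>eliminating the linear coefficient from the two equations\<close>
    have "(s - t) * (L * s * t + \<gamma>) = t * ?q s - s * ?q t"
      by (simp add: algebra_simps power2_eq_square)
    then have "(s - t) * (L * s * t + \<gamma>) = 0" using s t(3) by simp
    moreover have "L * s * t + \<gamma> > 0" using s tpos L \<open>\<gamma> > 0\<close> by (simp add: add_pos_pos)
    ultimately show "s = t" by simp
  qed (use t tpos in auto)
  then show "0 < \<theta>" "\<theta> \<le> 1" "(1 - \<theta>) * \<gamma> + \<theta> * l = L * \<theta>\<^sup>2"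
    using t tpos by (auto simp: algebra_simps)
qed

text \<open>Each new value is \<open>L * \<theta>\<^sup>2\<close> with a positive root, hence
  positive even for \<open>l = 0\<close>.\<close>

lemma est_gamma_pos:
  assumes "L > 0" and "l \<le> L"
  shows "est_gamma L l k > 0"
proof (induction k)
  case (Suc k)
  then show ?case
    using theta_root_properties[OF assms(1) Suc assms(2)] assms(1) by simp
qed (use assms in simp)

text \<open>Apart from a gradient term invisible to \<open>u\<close>, each new vector is an average
  of the previous one and \<open>xb k\<close>, with weights summing to one. Testing against a single
  \<open>u\<close> replaces membership in an affine span.\<close>

lemma inner_est_v_eq:
  assumes "L > 0" and "l \<le> L"
    and "\<And>j. j < k \<Longrightarrow> u \<bullet> grad f (xb j) = 0" and "\<And>j. j < k \<Longrightarrow> u \<bullet> xb j = u \<bullet> v0"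
  shows "u \<bullet> est_v f L l xb v0 k = u \<bullet> v0"
  using assms(3,4)
proof (induction k)
  case (Suc k)
  let ?th = "est_theta L l k" and ?ga = "est_gamma L l k"
  have ga': "est_gamma L l (Suc k) = (1 - ?th) * ?ga + ?th * l"
    by (simp add: est_theta_def)
  have "u \<bullet> est_v f L l xb v0 (Suc k)
      = ((1 - ?th) * ?ga * (u \<bullet> v0) + ?th * l * (u \<bullet> v0)) / est_gamma L l (Suc k)"
    using Suc by (simp add: Let_def inner_add_right inner_diff_right del: est_gamma.simps)
  also have "\<dots> = u \<bullet> v0"
    using est_gamma_pos[OF assms(1,2), of "Suc k"]
    by (simp add: ga' distrib_right[symmetric] del: est_gamma.simps)
  finally show ?case .
qed simp

lemma L_smooth_descent:
  assumes "L > 0" and "L_smooth L f"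
  shows "f (x - (1 / L) *\<^sub>R grad f x) \<le> f x - (norm (grad f x))\<^sup>2 / (2 * L)"
proof -
  let ?g = "grad f x" and ?y = "x - (1 / L) *\<^sub>R grad f x"
  have "f ?y - f x - ?g \<bullet> (?y - x) \<le> L / 2 * (norm (x - ?y))\<^sup>2"
    using assms(2) unfolding L_smooth_def by blast
  moreover have "?g \<bullet> (?y - x) = - (norm ?g)\<^sup>2 / L"
    by (simp add: power2_norm_eq_inner)
  moreover have "L / 2 * (norm (x - ?y))\<^sup>2 = (norm ?g)\<^sup>2 / (2 * L)"
    using assms(1) by (simp add: power_divide power2_eq_square)
  moreover have "(norm ?g)\<^sup>2 / L = 2 * ((norm ?g)\<^sup>2 / (2 * L))" by simp
  ultimately show ?thesis by linarith
qed

theorem theorem2: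
  fixes A :: "real^'n^'n" and b x0 :: "real^'n" and L l :: real and k :: nat
    and f :: "real^'n \<Rightarrow> real" and x :: "nat \<Rightarrow> real^'n"
  assumes "sym_pos_def A"
    and f: "f = quadratic A b"
    and "L > 0" and "l \<ge> 0"
    and "L_smooth L f" and "strongly_convex l f"
    and x: "x = cg_x f A x0"
    and "cg_defined f A x0 k"
  shows "f (x k) \<le> est_phi f L l x x0 x0 k"
proof -
  have At: "transpose A = A" and Apos: "\<And>u. u \<noteq> 0 \<Longrightarrow> u \<bullet> (A *v u) > 0"
    using assms(1) unfolding sym_pos_def_def by auto
  have Asym: "u \<bullet> (A *v v) = v \<bullet> (A *v u)" for u v
    by (metis At dot_lmul_matrix inner_commute transpose_matrix_vector)
  have convex: "f y \<ge> f z + grad f z \<bullet> (y - z)" for y z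
    using \<open>L_smooth L f\<close> unfolding L_smooth_def by (smt (verit))
  have lL: "l \<le> L"
  proof -
    \<comment> \<open>At two points a unit distance apart, the lower and upper quadratic bounds
      compare \<open>l\<close> with \<open>L\<close> directly.\<close>
    obtain u :: "real^'n" where "norm u = 1" using vector_choose_size[of 1] by auto
    then have u: "norm (0 - u) = 1" by simp
    have "l / 2 * (norm (0 - u))\<^sup>2 \<le> L / 2 * (norm (0 - u))\<^sup>2"
      using assms(5,6) unfolding L_smooth_def strongly_convex_def by (meson order_trans)
    then show ?thesis unfolding u by simp
  qed
  define g where "g j = grad f (x j)" for j
  define p where "p j = snd (cg_state f A x0 j)" for j
  define a where "a j = - (g j \<bullet> p j) / (p j \<bullet> (A *v p j))" for j
  have x_0: "x 0 = x0" and p_0: "p 0 = - g 0"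
    by (simp_all add: x cg_x_def p_def g_def)
  have x_Suc: "x (Suc j) = x j + a j *\<^sub>R p j" for j
    by (simp add: x cg_x_def p_def g_def a_def Let_def)
  have p_Suc: "p (Suc j) = - g (Suc j) + ((norm (g (Suc j)))\<^sup>2 / (norm (g j))\<^sup>2) *\<^sub>R p j" for j
    by (simp add: x cg_x_def p_def g_def Let_def)
  have g_Suc: "g (Suc j) = g j + a j *\<^sub>R (A *v p j)" for j
    by (simp add: g_def f grad_quadratic[OF At] x_Suc matrix_vector_right_distrib
        matrix_vector_mult_scaleR)
  \<comment> \<open>Only gradients before \<open>m\<close> must be nonzero, so this also covers the
    iterate at which the method stops.\<close>
  have orth: "g m \<bullet> g j = 0" "g m \<bullet> p j = 0" if "\<And>i. i < m \<Longrightarrow> g i \<noteq> 0" "j < m" for m j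
    using conjugate_gradient_orthogonality[of "(*v) A" a g p m, OF Asym Apos a_def p_0 g_Suc p_Suc
        that(1)] that(2) by auto
  have "\<And>j. j < k \<Longrightarrow> g j \<noteq> 0"
    using assms(8) by (simp add: cg_defined_def g_def x)
  then show ?thesis
  proof (induction k)
    case 0
    then show ?case by (simp add: x_0)
  next
    case (Suc k)
    have IH: "f (x k) \<le> est_phi f L l x x0 x0 k" using Suc by simp
    let ?th = "est_theta L l k" and ?ga = "est_gamma L l k" and ?ga' = "est_gamma L l (Suc k)"
    let ?v = "est_v f L l x x0 k"
    have ga: "?ga > 0" "?ga' > 0"
      by (rule est_gamma_pos[OF \<open>L > 0\<close> lL])+
    note th = theta_root_properties[OF \<open>L > 0\<close> ga(1) lL, folded est_theta_def]
    have ga': "?ga' = L * ?th\<^sup>2" using th(3) by (simp add: est_theta_def)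
    have gx: "g k \<bullet> x m = g k \<bullet> x0" if "m \<le> k" for m
      using that
    proof (induction m)
      case (Suc m)
      then show ?case
        using orth(2)[of k m] Suc.prems \<open>\<And>j. j < Suc k \<Longrightarrow> g j \<noteq> 0\<close>
        by (simp add: x_Suc inner_add_right)
    qed (simp add: x_0)
    have "g k \<bullet> ?v = g k \<bullet> x0"
      by (rule inner_est_v_eq[OF \<open>L > 0\<close> lL])
        (use orth(1)[of k] Suc.prems gx in \<open>auto simp: g_def\<close>)
    then have gv: "g k \<bullet> (?v - x k) = 0" using gx[of k] by (simp add: inner_diff_right)
    let ?y = "x k - (1 / L) *\<^sub>R g k"
    \<comment> \<open>The difference is a combination of \<open>g k\<close> and \<open>p k\<close>,
      so the tangent plane at \<open>x (Suc k)\<close> takes the value \<open>f (x (Suc k))\<close>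
      at \<open>?y\<close>.\<close>
    have "g (Suc k) \<bullet> (?y - x (Suc k)) = 0"
      using orth[of "Suc k" k] Suc.prems
      by (simp add: x_Suc inner_diff_right inner_add_right)
    then have "f (x (Suc k)) \<le> f ?y"
      using convex[of "x (Suc k)" ?y] by (simp add: g_def)
    also have "\<dots> \<le> f (x k) - (norm (g k))\<^sup>2 / (2 * L)"
      unfolding g_def by (rule L_smooth_descent[OF \<open>L > 0\<close> \<open>L_smooth L f\<close>])
    also have "\<dots> \<le> (1 - ?th) * est_phi f L l x x0 x0 k + ?th * f (x k)
        - ?th\<^sup>2 / (2 * ?ga') * (norm (g k))\<^sup>2
        + ?th * (1 - ?th) * ?ga / ?ga' * (l / 2 * (norm (x k - ?v))\<^sup>2 + g k \<bullet> (?v - x k))"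
    proof -
      have "(1 - ?th) * f (x k) \<le> (1 - ?th) * est_phi f L l x x0 x0 k"
        using IH th(2) by (intro mult_left_mono) auto
      moreover have "?th\<^sup>2 / (2 * ?ga') * (norm (g k))\<^sup>2 = (norm (g k))\<^sup>2 / (2 * L)"
        unfolding ga' using th(1) by simp
      \<comment> \<open>By \<open>gv\<close> only the squared distance remains in the bracket, with
        a nonnegative coefficient.\<close>
      moreover have "0 \<le> ?th * (1 - ?th) * ?ga / ?ga' * (l / 2 * (norm (x k - ?v))\<^sup>2 + g k \<bullet> (?v - x k))"
        unfolding gv using th(1,2) ga \<open>l \<ge> 0\<close>
        by (intro mult_nonneg_nonneg divide_nonneg_pos) auto
      ultimately show ?thesis by (simp add: algebra_simps)
    qed
    also have "\<dots> = est_phi f L l x x0 x0 (Suc k)"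
      by (simp add: Let_def g_def del: est_gamma.simps)
    finally show ?case .
  qed
qed

end
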